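(* Let $\lambda>0$ and let $0<\varepsilon<L<L'$ be given. Let $\Theta$ be an $(L,\varepsilon)$-plateau function and let $K_0>1$ be such that, for every $\kappa\ge K_0$, the function $\Theta_\kappa:=\kappa\Theta$ satisfies $\Theta_\kappa''+2\lambda\Theta_\kappa\ln\Theta_\kappa\ge0$ on $\mathbb{R}$. Select $K\ge K_0$. Let $u_0\in\mathrm{BPC}^2(\mathbb{R})$ be such that $u_0>0$ on $(-L',L')$ and $u_0\equiv0$ on $(-\infty,-L']\cup[L',+\infty)$. For $M>0$, denote by $u_M(t,x)$ the solution of $\partial_tu=\partial_{xx}u+\lambda u\ln(u^2)$, $t>0$, $x\in\mathbb{R}$, starting from $Mu_0$. (i) There is $M_{\rm decay}>0$ such that, for any $0<M<M_{\rm decay}$, the solution $u_M$ decays superexponentially in time: there are $C,\eta>0$ with $\|u_M(t,\cdot)\|_{L^\infty(\mathbb{R})}\le Ce^{-\eta e^{2\lambda t}}$ for all $t\ge0$. (ii) There is $M_{\rm growth}>0$ such that, for any $M>M_{\rm growth}$, the solution $u_M$ grows locally superexponentially in time, in the sense that $$u_M(t,x)\ge K\,e^{\left(\ln\frac{K+1}{K}\right)e^{2\lambda t}},\qquad\forall t\ge0,\ \forall x\in[-L+\varepsilon,L-\varepsilon].$$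
   Context: $\mathrm{BPC}^2(\mathbb{R})$ denotes the set of functions $\mathbb{R}\to\mathbb{R}$ that are continuous and bounded, with continuous and bounded derivative, and bounded and piecewise continuous second derivative. The functions $z\mapsto z\ln z$ and $z\mapsto z\ln(z^2)$ are extended by the value $0$ at $z=0$. An $(L,\varepsilon)$-plateau function is a function $\Theta:\mathbb{R}\to\mathbb{R}$ with $\Theta\in C^\infty([-L,L])\cap\mathrm{BPC}^2(\mathbb{R})$ such that $\Theta(x)=0$ for $|x|\ge L$; $\Theta>0$ on $(-L,L)$; $\Theta(\pm L)=\Theta'(\pm L)=\Theta''(\pm L)=0$; $\Theta'''(-L)=-\Theta'''(L)>0$ (one-sided derivatives from inside $[-L,L]$); and $\Theta\equiv1$ on $[-L+\varepsilon,L-\varepsilon]$. (For any such $\Theta$ a constant $K_0>1$ as in the claim exists.) Notion of solution: for $v_0\in\mathrm{BPC}^2(\mathbb{R})$, a (global) solution starting from $v_0$ is a function $u:[0,\infty)\times\mathbb{R}\to\mathbb{R}$ such that, for every $T>0$: $u$ is continuous and bounded on $[0,T]\times\mathbb{R}$; $u_t,u_x,u_{xx}$ exist and are continuous on $(0,T]\times\mathbb{R}$; $u$ satisfies the equation on $(0,T]\times\mathbb{R}$; $u(t,x)$ is uniformly bounded as $|x|\to\infty$ for $t\in[0,T]$; and $u(0,\cdot)=v_0$. For $v_0\ge0$ such a solution exists and is unique. *)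

theory Defs
  imports "HOL-Probability.Essential_Supremum"
begin

text \<open>
  The second derivative of a \<open>BPC2\<close> function may fail to exist on a locally finite set
  \<open>D\<close> of break points.  Piecewise continuity means continuity off \<open>D\<close> together with
  finite one-sided limits at the points of \<open>D\<close>.
\<close>

definition BPC2 :: "(real \<Rightarrow> real) \<Rightarrow> bool" where
  "BPC2 f \<longleftrightarrow>
     continuous_on UNIV f \<and> bounded (range f) \<and>
     (\<forall>x. f differentiable (at x)) \<and>
     continuous_on UNIV (deriv f) \<and> bounded (range (deriv f)) \<and>
     (\<exists>D. (\<forall>a b. finite (D \<inter> {a..b})) \<and>
          (\<forall>x. x \<notin> D \<longrightarrow> deriv f differentiable (at x)) \<and>
          continuous_on (- D) (deriv (deriv f)) \<and>
          bounded (deriv (deriv f) ` (- D)) \<and>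
          (\<forall>x\<in>D. (\<exists>l. (deriv (deriv f) \<longlongrightarrow> l) (at_left x)) \<and>
                   (\<exists>r. (deriv (deriv f) \<longlongrightarrow> r) (at_right x))))"

text \<open>
  Iterated derivatives relative to a set \<open>S\<close>.  For \<open>S = {a..b}\<close> with \<open>a < b\<close> these are
  one-sided at the end points, and on \<open>S\<close> they depend only on the values of \<open>f\<close> on \<open>S\<close>.
\<close>

definition nderiv_on :: "real set \<Rightarrow> nat \<Rightarrow> (real \<Rightarrow> real) \<Rightarrow> real \<Rightarrow> real" where
  "nderiv_on S n f = ((\<lambda>g x. vector_derivative g (at x within S)) ^^ n) f"

definition smooth_on :: "real set \<Rightarrow> (real \<Rightarrow> real) \<Rightarrow> bool" where
  "smooth_on S f \<longleftrightarrow> (\<forall>n. nderiv_on S n f differentiable_on S)"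

definition plateau_function :: "real \<Rightarrow> real \<Rightarrow> (real \<Rightarrow> real) \<Rightarrow> bool" where
  "plateau_function L \<epsilon> \<Theta> \<longleftrightarrow>
     smooth_on {-L..L} \<Theta> \<and> BPC2 \<Theta> \<and>
     (\<forall>x. \<bar>x\<bar> \<ge> L \<longrightarrow> \<Theta> x = 0) \<and>
     (\<forall>x\<in>{-L<..<L}. \<Theta> x > 0) \<and>
     (\<forall>k\<in>{0, 1, 2}. nderiv_on {-L..L} k \<Theta> (-L) = 0 \<and> nderiv_on {-L..L} k \<Theta> L = 0) \<and>
     nderiv_on {-L..L} 3 \<Theta> (-L) = - nderiv_on {-L..L} 3 \<Theta> L \<and>
     nderiv_on {-L..L} 3 \<Theta> (-L) > 0 \<and>
     (\<forall>x\<in>{-L + \<epsilon>..L - \<epsilon>}. \<Theta> x = 1)"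

text \<open>
  Global solutions of \<open>u\<^sub>t = u\<^sub>x\<^sub>x + lam u ln (u\<^sup>2)\<close> starting from \<open>v0\<close>.  Only the values
  \<open>u t x\<close> with \<open>t \<ge> 0\<close> matter.  The product \<open>z * ln (z\<^sup>2)\<close> is \<open>0\<close> at \<open>z = 0\<close>, which is
  its continuous extension.
\<close>

definition log_heat_solution :: "real \<Rightarrow> (real \<Rightarrow> real) \<Rightarrow> (real \<Rightarrow> real \<Rightarrow> real) \<Rightarrow> bool" where
  "log_heat_solution lam v0 u \<longleftrightarrow>
     (\<forall>T>0.
        continuous_on ({0..T} \<times> UNIV) (\<lambda>(t, x). u t x) \<and>
        bounded ((\<lambda>(t, x). u t x) ` ({0..T} \<times> UNIV)) \<and>
        (\<forall>t\<in>{0<..T}. \<forall>x.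
           (\<lambda>s. u s x) differentiable (at t) \<and>
           u t differentiable (at x) \<and>
           deriv (u t) differentiable (at x)) \<and>
        continuous_on ({0<..T} \<times> UNIV) (\<lambda>(t, x). deriv (\<lambda>s. u s x) t) \<and>
        continuous_on ({0<..T} \<times> UNIV) (\<lambda>(t, x). deriv (u t) x) \<and>
        continuous_on ({0<..T} \<times> UNIV) (\<lambda>(t, x). deriv (deriv (u t)) x) \<and>
        (\<forall>t\<in>{0<..T}. \<forall>x.
           deriv (\<lambda>s. u s x) t = deriv (deriv (u t)) x + lam * u t x * ln ((u t x)\<^sup>2)) \<and>
        (\<exists>R B. \<forall>t\<in>{0..T}. \<forall>x. \<bar>x\<bar> \<ge> R \<longrightarrow> \<bar>u t x\<bar> \<le> B)) \<and>
     (\<forall>x. u 0 x = v0 x)"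

definition Linf_norm :: "(real \<Rightarrow> real) \<Rightarrow> ereal" where
  "Linf_norm f = esssup lborel (\<lambda>x. ereal \<bar>f x\<bar>)"

end

theory Submission
  imports Defs
begin

text \<open>
  The nonlinearity \<open>z \<mapsto> z ln (z\<^sup>2)\<close> is not Lipschitz at \<open>0\<close>, but its slope there is
  \<open>-\<infinity>\<close>, so it is one-sided Lipschitz on bounded sets; this is all the comparison principle
  needs.  Writing \<open>\<phi>\<^sub>c(t) = exp (c exp (2 lam t))\<close>, which solves \<open>\<phi>' = lam \<phi> ln (\<phi>\<^sup>2)\<close>, decay
  follows by trapping \<open>u\<^sub>M\<close> between \<open>\<plusminus>\<phi>\<^sub>c\<close> with \<open>c < 0\<close>.  For growth, \<open>\<phi>\<^sub>c(t) K \<Theta>(x)\<close> with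
  \<open>c = ln ((K + 1) / K)\<close> is a subsolution that vanishes at \<open>\<plusminus>L\<close>, so it is enough to compare
  on \<open>[-L, L]\<close>.
\<close>

section \<open>Necessary conditions at a maximum and the parabolic maximum principle\<close>

text \<open>If \<open>d > 0\<close>, then \<open>h'\<close>, which vanishes at \<open>x\<close>, is
  positive just to the right of \<open>x\<close>, so \<open>h\<close> rises above its
  maximum.\<close>

lemma second_derivative_at_local_max:
  fixes h h' :: "real \<Rightarrow> real"
  assumes "open U" "x \<in> U"
    and h: "\<And>y. y \<in> U \<Longrightarrow> (h has_real_derivative h' y) (at y)"
    and h': "(h' has_real_derivative d) (at x)"
    and max: "\<And>y. y \<in> U \<Longrightarrow> h y \<le> h x"
  shows "d \<le> 0"
proof (rule ccontr)
  assume "\<not> d \<le> 0"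
  then have "d > 0" by simp
  obtain r where r: "r > 0" "ball x r \<subseteq> U"
    using assms(1,2) open_contains_ball by blast
  have "h' x = 0"
    using DERIV_local_max[OF h[OF \<open>x \<in> U\<close>] \<open>r > 0\<close>] max r
    by (auto simp: subset_iff dist_real_def)
  obtain e where e: "e > 0" "\<And>k. 0 < k \<Longrightarrow> k < e \<Longrightarrow> h' x < h' (x + k)"
    using DERIV_pos_inc_right[OF h' \<open>d > 0\<close>] by blast
  define k where "k = min r e / 2"
  have k: "0 < k" "k < r" "k < e"
    using r(1) e(1) by (auto simp: k_def)
  have in_U: "y \<in> U" if "x \<le> y" "y \<le> x + k" for y
    using that k r by (auto simp: subset_iff dist_real_def)
  have "h x < h (x + k)"
  proof (rule DERIV_pos_imp_increasing_open[where f = h])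
    show "\<exists>y. (h has_real_derivative y) (at z) \<and> y > 0" if "x < z" "z < x + k" for z
    proof -
      have "0 < h' z"
        using e(2)[of "z - x"] that k \<open>h' x = 0\<close> by simp
      then show ?thesis
        using h[of z] in_U[of z] that by auto
    qed
    show "continuous_on {x..x + k} h"
      using DERIV_isCont[OF h] in_U by (intro continuous_at_imp_continuous_on) auto
  qed (use k in simp)
  then show False
    using max[of "x + k"] in_U[of "x + k"] k by simp
qed

text \<open>Only earlier times are compared, because a maximum over \<open>{0..T}\<close> may be
  attained at the final time.\<close>

lemma derivative_at_left_max:
  fixes h :: "real \<Rightarrow> real"
  assumes h: "(h has_real_derivative d) (at t)"
    and "a < t" and max: "\<And>s. a \<le> s \<Longrightarrow> s \<le> t \<Longrightarrow> h s \<le> h t"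
  shows "d \<ge> 0"
proof (rule ccontr)
  assume "\<not> d \<ge> 0"
  then obtain e where e: "e > 0" "\<And>k. 0 < k \<Longrightarrow> k < e \<Longrightarrow> h t < h (t - k)"
    using DERIV_neg_dec_left[OF h] by auto
  define k where "k = min e (t - a) / 2"
  have "0 < k" "k < e" "a \<le> t - k"
    using e(1) \<open>a < t\<close> by (auto simp: k_def min_def field_simps)
  then show False
    using e(2)[of k] max[of "t - k"] by simp
qed

text \<open>The factor \<open>exp (- C * t)\<close> absorbs the zero-order term, and a small penalty
  growing in \<open>x\<close> forces a maximum to exist even when \<open>S\<close> is unbounded. The
  differential inequality is asked only where \<open>z\<close> is positive, which is what lets a
  one-sided Lipschitz reaction term be treated.\<close>

lemma parabolic_maximum_principle:
  fixes z zx :: "real \<Rightarrow> real \<Rightarrow> real"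
  assumes "closed S" and "C \<ge> 0"
    and cont: "continuous_on ({0..T} \<times> S) (\<lambda>(t, x). z t x)"
    and bdd: "\<And>t x. t \<in> {0..T} \<Longrightarrow> x \<in> S \<Longrightarrow> z t x \<le> B"
    and init: "\<And>x. x \<in> S \<Longrightarrow> z 0 x \<le> 0"
    and bdry: "\<And>t x. t \<in> {0..T} \<Longrightarrow> x \<in> frontier S \<Longrightarrow> z t x \<le> 0"
    and zx: "\<And>t x. t \<in> {0<..T} \<Longrightarrow> x \<in> interior S \<Longrightarrow> (z t has_real_derivative zx t x) (at x)"
    and ineq: "\<And>t x. t \<in> {0<..T} \<Longrightarrow> x \<in> interior S \<Longrightarrow> z t x > 0 \<Longrightarrow>
      \<exists>zt zxx. ((\<lambda>s. z s x) has_real_derivative zt) (at t) \<and>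
        (zx t has_real_derivative zxx) (at x) \<and> zt \<le> zxx + C * z t x"
    and "t1 \<in> {0..T}" "x1 \<in> S"
  shows "z t1 x1 \<le> 0"
proof (rule ccontr)
  assume "\<not> z t1 x1 \<le> 0"
  then have pos: "z t1 x1 > 0" by simp
  \<comment> \<open>This size makes the penalized function \<open>\<psi>\<close> equal to
    \<open>\<delta>\<close> itself at \<open>(t1, x1)\<close>, hence positive there.\<close>
  define \<delta> where "\<delta> = exp (- C * t1) * z t1 x1 / (1 + x1\<^sup>2 + 3 * t1)"
  \<comment> \<open>The weight 3 on \<open>t\<close> exceeds the second derivative 2 of
    \<open>x\<^sup>2\<close>; the surplus makes the final contradiction strict.\<close>
  define \<psi> where "\<psi> = (\<lambda>t x. exp (- C * t) * z t x - \<delta> * (x\<^sup>2 + 3 * t))"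
  have den: "1 + x1\<^sup>2 + 3 * t1 > 0"
    using assms(9) by (simp add: add_pos_nonneg)
  have \<delta>: "\<delta> > 0"
    unfolding \<delta>_def using pos den by simp
  have "\<psi> t1 x1 = \<delta> * (1 + x1\<^sup>2 + 3 * t1) - \<delta> * (x1\<^sup>2 + 3 * t1)"
    unfolding \<psi>_def \<delta>_def using den by simp
  also have "\<dots> = \<delta>" by (simp add: algebra_simps)
  finally have \<psi>1: "\<psi> t1 x1 > 0" using \<delta> by simp
  \<comment> \<open>Beyond this radius the penalty outweighs the upper bound of \<open>z\<close>, so
    a positive maximum of \<open>\<psi>\<close> lies in a compact set, which also contains
    \<open>x1\<close>.\<close>
  define R where "R = max \<bar>x1\<bar> (sqrt (\<bar>B\<bar> / \<delta>))"
  have R: "R \<ge> 0" "\<bar>x1\<bar> \<le> R" "\<bar>B\<bar> \<le> \<delta> * R\<^sup>2"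
  proof -
    show "R \<ge> 0" "\<bar>x1\<bar> \<le> R" unfolding R_def by auto
    have "(sqrt (\<bar>B\<bar> / \<delta>))\<^sup>2 \<le> R\<^sup>2"
      unfolding R_def using \<delta> by (intro power_mono) auto
    then show "\<bar>B\<bar> \<le> \<delta> * R\<^sup>2" using \<delta> by (simp add: field_simps)
  qed
  have far: "\<psi> t x \<le> 0" if "t \<in> {0..T}" "x \<in> S" "\<bar>x\<bar> > R" for t x
  proof -
    have "exp (- C * t) * z t x \<le> exp (- C * t) * \<bar>B\<bar>"
      using bdd[OF that(1,2)] by simp
    also have "\<dots> \<le> 1 * \<bar>B\<bar>"
      using \<open>C \<ge> 0\<close> that(1) by (intro mult_right_mono) auto
    also have "\<dots> \<le> \<delta> * R\<^sup>2" using R by simp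
    also have "\<dots> \<le> \<delta> * (x\<^sup>2 + 3 * t)"
      using \<delta> R that abs_le_square_iff[of R x] by (intro mult_left_mono) auto
    finally show ?thesis unfolding \<psi>_def by simp
  qed
  have "compact ({0..T} \<times> (S \<inter> {-R..R}))"
    using \<open>closed S\<close> by (intro compact_Times closed_Int_compact) auto
  moreover have "(t1, x1) \<in> {0..T} \<times> (S \<inter> {-R..R})"
    using assms(9,10) R by auto
  moreover have "continuous_on ({0..T} \<times> (S \<inter> {-R..R})) (\<lambda>p. \<psi> (fst p) (snd p))"
  proof -
    have "continuous_on ({0..T} \<times> (S \<inter> {-R..R})) (\<lambda>p. z (fst p) (snd p))"
      using cont unfolding case_prod_beta by (rule continuous_on_subset) auto
    then show ?thesis
      unfolding \<psi>_def by (intro continuous_intros)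
  qed
  ultimately obtain p where p: "p \<in> {0..T} \<times> (S \<inter> {-R..R})"
    "\<forall>q\<in>{0..T} \<times> (S \<inter> {-R..R}). \<psi> (fst q) (snd q) \<le> \<psi> (fst p) (snd p)"
    using continuous_attains_sup[of "{0..T} \<times> (S \<inter> {-R..R})"] by blast
  obtain t0 x0 where [simp]: "p = (t0, x0)" by fastforce
  have mem: "t0 \<in> {0..T}" "x0 \<in> S" using p(1) by auto
  have \<psi>0: "\<psi> t0 x0 > 0"
    using bspec[OF p(2) \<open>(t1, x1) \<in> _\<close>] \<psi>1 by simp
  have max: "\<psi> t x \<le> \<psi> t0 x0" if "t \<in> {0..T}" "x \<in> S" for t x
  proof (cases "\<bar>x\<bar> > R")
    case True
    then show ?thesis using far[OF that] \<psi>0 by linarith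
  next
    case False
    then have "(t, x) \<in> {0..T} \<times> (S \<inter> {-R..R})" using that by auto
    from bspec[OF p(2) this] show ?thesis by simp
  qed
  \<comment> \<open>Positivity rules out the initial time and the boundary, and makes
    \<open>ineq\<close> available at the maximum point.\<close>
  have z0: "z t0 x0 > 0"
  proof -
    have "0 \<le> \<delta> * (x0\<^sup>2 + 3 * t0)" using \<delta> mem by simp
    then have "0 < exp (- C * t0) * z t0 x0" using \<psi>0 unfolding \<psi>_def by linarith
    then show ?thesis by (simp add: zero_less_mult_iff)
  qed
  have t0: "t0 \<in> {0<..T}"
    using init[OF mem(2)] z0 mem(1) by (cases "t0 = 0") auto
  have x0: "x0 \<in> interior S"
    using bdry[OF mem(1), of x0] z0 mem(2) \<open>closed S\<close> by (fastforce simp: frontier_def)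
  obtain zt zxx where d: "((\<lambda>s. z s x0) has_real_derivative zt) (at t0)"
    "(zx t0 has_real_derivative zxx) (at x0)" "zt \<le> zxx + C * z t0 x0"
    using ineq[OF t0 x0 z0] by blast
  have "((\<lambda>t. \<psi> t x0) has_real_derivative
      (exp (- C * t0) * (zt - C * z t0 x0) - 3 * \<delta>)) (at t0)"
    unfolding \<psi>_def by (rule derivative_eq_intros d(1) refl | simp add: algebra_simps)+
  then have A: "exp (- C * t0) * (zt - C * z t0 x0) - 3 * \<delta> \<ge> 0"
    by (rule derivative_at_left_max[where a = 0]) (use t0 max mem in auto)
  have B: "exp (- C * t0) * zxx - 2 * \<delta> \<le> 0"
  proof (rule second_derivative_at_local_max[OF open_interior x0])
    show "(\<psi> t0 has_real_derivative exp (- C * t0) * zx t0 y - \<delta> * (2 * y)) (at y)"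
      if "y \<in> interior S" for y
      unfolding \<psi>_def
      by (rule derivative_eq_intros zx[OF t0 that] refl | simp add: algebra_simps)+
    show "((\<lambda>y. exp (- C * t0) * zx t0 y - \<delta> * (2 * y)) has_real_derivative
        exp (- C * t0) * zxx - 2 * \<delta>) (at x0)"
      by (rule derivative_eq_intros d(2) refl | simp add: algebra_simps)+
    show "\<psi> t0 y \<le> \<psi> t0 x0" if "y \<in> interior S" for y
      using max mem(1) that interior_subset by blast
  qed
  \<comment> \<open>Chaining this with \<open>A\<close> and \<open>B\<close> gives
    \<open>3 * \<delta> \<le> 2 * \<delta>\<close>.\<close>
  have "exp (- C * t0) * (zt - C * z t0 x0) \<le> exp (- C * t0) * zxx"
    using d(3) by (intro mult_left_mono) auto
  then show False using A B \<delta> by linarith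
qed

section \<open>One-sided Lipschitz estimates for the nonlinearity and the comparison
  principle\<close>

text \<open>The constant exceeds \<open>2 * ln B\<close> so as to agree with the bound for
  differences below.\<close>

lemma mult_ln_square_bound:
  fixes a B :: real
  assumes "0 \<le> a" "a \<le> B" "B \<ge> 1"
  shows "a * ln (a\<^sup>2) \<le> (2 * ln B + 2) * a"
proof (cases "a = 0")
  case False
  then have "ln a \<le> ln B" "ln B \<ge> 0" using assms by simp_all
  moreover have "ln (a\<^sup>2) = 2 * ln a"
    using assms False by (simp add: ln_realpow)
  ultimately have "ln (a\<^sup>2) \<le> 2 * ln B + 2" by linarith
  then show ?thesis
    using mult_left_mono[OF _ assms(1)] by (metis mult.commute)
qed simp

text \<open>Half of the difference splits as \<open>(a - b) * ln a + b * (ln a - ln b)\<close>. The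
  first term is controlled by \<open>ln B\<close>, the second by \<open>ln s \<le> s - 1\<close> at
  \<open>s = a / b\<close>.\<close>

lemma mult_ln_square_diff_pos:
  fixes a b B :: real
  assumes "0 \<le> b" "b < a" "a \<le> B" "B \<ge> 1"
  shows "a * ln (a\<^sup>2) - b * ln (b\<^sup>2) \<le> (2 * ln B + 2) * (a - b)"
proof (cases "b = 0")
  case True
  then show ?thesis using mult_ln_square_bound[of a B] assms by simp
next
  case False
  then have b: "b > 0" using assms by simp
  have "b * (ln a - ln b) = b * ln (a / b)" using b assms by (simp add: ln_div)
  also have "\<dots> \<le> b * (a / b - 1)"
    using b assms by (intro mult_left_mono ln_le_minus_one) auto
  also have "\<dots> = a - b" using b by (simp add: field_simps)
  finally have 1: "b * (ln a - ln b) \<le> a - b" .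
  have 2: "(a - b) * ln a \<le> (a - b) * ln B"
    using assms b by (intro mult_left_mono) auto
  have "a * ln (a\<^sup>2) - b * ln (b\<^sup>2) = 2 * ((a - b) * ln a + b * (ln a - ln b))"
    using b assms by (simp add: ln_realpow algebra_simps)
  also have "\<dots> \<le> 2 * ((a - b) * ln B + (a - b))"
    using 1 2 by simp
  finally show ?thesis by (simp add: algebra_simps)
qed

text \<open>For equal signs the previous estimate applies, after reflection in the negative case
  because the nonlinearity is odd. For opposite signs the bounds at \<open>a\<close> and
  \<open>- b\<close> add up, since \<open>a - b\<close> is the sum of the absolute values.\<close>

lemma mult_ln_square_one_sided_lipschitz:
  fixes a b B :: real
  assumes "b < a" "a \<le> B" "- B \<le> b" "B \<ge> 1"
  shows "a * ln (a\<^sup>2) - b * ln (b\<^sup>2) \<le> (2 * ln B + 2) * (a - b)"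
proof -
  consider "0 \<le> b" | "a \<le> 0" | "b \<le> 0" "0 \<le> a" by linarith
  then show ?thesis
  proof cases
    case 1
    then show ?thesis using mult_ln_square_diff_pos assms by blast
  next
    case 2
    then show ?thesis using mult_ln_square_diff_pos[of "-a" "-b" B] assms by simp
  next
    case 3
    then show ?thesis
      using mult_ln_square_bound[of a B] mult_ln_square_bound[of "-b" B] assms
      by (simp add: algebra_simps)
  qed
qed

text \<open>The maximum principle is applied to \<open>v - u\<close>: wherever this is positive, the
  reaction terms differ by at most a constant times it. The set \<open>S\<close> is left general
  because both the whole line and \<open>{-L..L}\<close> are needed.\<close>

lemma log_heat_comparison:
  fixes v u vx ux :: "real \<Rightarrow> real \<Rightarrow> real"
  assumes "closed S" and "lam > 0"
    and cont: "continuous_on ({0..T} \<times> S) (\<lambda>(t, x). v t x)"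
      "continuous_on ({0..T} \<times> S) (\<lambda>(t, x). u t x)"
    and bdd: "\<And>t x. t \<in> {0..T} \<Longrightarrow> x \<in> S \<Longrightarrow> v t x \<le> Bv"
      "\<And>t x. t \<in> {0..T} \<Longrightarrow> x \<in> S \<Longrightarrow> - Bu \<le> u t x"
    and init: "\<And>x. x \<in> S \<Longrightarrow> v 0 x \<le> u 0 x"
    and bdry: "\<And>t x. t \<in> {0..T} \<Longrightarrow> x \<in> frontier S \<Longrightarrow> v t x \<le> u t x"
    and vx: "\<And>t x. t \<in> {0<..T} \<Longrightarrow> x \<in> interior S \<Longrightarrow> (v t has_real_derivative vx t x) (at x)"
    and ux: "\<And>t x. t \<in> {0<..T} \<Longrightarrow> x \<in> interior S \<Longrightarrow> (u t has_real_derivative ux t x) (at x)"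
    and sub: "\<And>t x. t \<in> {0<..T} \<Longrightarrow> x \<in> interior S \<Longrightarrow>
      \<exists>vt vxx. ((\<lambda>s. v s x) has_real_derivative vt) (at t) \<and>
        (vx t has_real_derivative vxx) (at x) \<and> vt \<le> vxx + lam * v t x * ln ((v t x)\<^sup>2)"
    and super: "\<And>t x. t \<in> {0<..T} \<Longrightarrow> x \<in> interior S \<Longrightarrow>
      \<exists>ut uxx. ((\<lambda>s. u s x) has_real_derivative ut) (at t) \<and>
        (ux t has_real_derivative uxx) (at x) \<and> uxx + lam * u t x * ln ((u t x)\<^sup>2) \<le> ut"
    and "t \<in> {0..T}" "x \<in> S"
  shows "v t x \<le> u t x"
proof -
  \<comment> \<open>Where \<open>v\<close> exceeds \<open>u\<close>, the upper bound on
    \<open>v\<close> and the lower bound on \<open>u\<close> confine both values to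
    \<open>{-B..B}\<close>.\<close>
  define B where "B = max 1 (max Bv Bu)"
  have B: "B \<ge> 1" "Bv \<le> B" "Bu \<le> B" by (auto simp: B_def)
  define C where "C = lam * (2 * ln B + 2)"
  have sub_S: "y \<in> S" if "y \<in> interior S" for y
    using that interior_subset by blast
  have "v t x - u t x \<le> 0"
  proof (rule parabolic_maximum_principle[where z = "\<lambda>t x. v t x - u t x"
        and zx = "\<lambda>t x. vx t x - ux t x" and C = C and S = S and T = T and B = "Bv + Bu"])
    show "C \<ge> 0" unfolding C_def using \<open>lam > 0\<close> B by simp
    show "continuous_on ({0..T} \<times> S) (\<lambda>(t, x). v t x - u t x)"
      using continuous_on_diff[OF cont] by (simp add: case_prod_beta)
    show "v s y - u s y \<le> Bv + Bu" if "s \<in> {0..T}" "y \<in> S" for s y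
      using bdd[OF that] by linarith
    show "((\<lambda>x. v s x - u s x) has_real_derivative vx s y - ux s y) (at y)"
      if "s \<in> {0<..T}" "y \<in> interior S" for s y
      using vx[OF that] ux[OF that] by (rule DERIV_diff)
    show "\<exists>zt zxx. ((\<lambda>s. v s y - u s y) has_real_derivative zt) (at s) \<and>
        ((\<lambda>y. vx s y - ux s y) has_real_derivative zxx) (at y) \<and> zt \<le> zxx + C * (v s y - u s y)"
      if s: "s \<in> {0<..T}" "y \<in> interior S" and pos: "v s y - u s y > 0" for s y
    proof -
      obtain vt vxx where V: "((\<lambda>s. v s y) has_real_derivative vt) (at s)"
        "(vx s has_real_derivative vxx) (at y)" "vt \<le> vxx + lam * v s y * ln ((v s y)\<^sup>2)"
        using sub[OF s] by blast
      obtain ut uxx where U: "((\<lambda>s. u s y) has_real_derivative ut) (at s)"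
        "(ux s has_real_derivative uxx) (at y)" "uxx + lam * u s y * ln ((u s y)\<^sup>2) \<le> ut"
        using super[OF s] by blast
      have "v s y * ln ((v s y)\<^sup>2) - u s y * ln ((u s y)\<^sup>2) \<le> (2 * ln B + 2) * (v s y - u s y)"
        using bdd[of s y] s sub_S B pos by (intro mult_ln_square_one_sided_lipschitz) force+
      then have "lam * (v s y * ln ((v s y)\<^sup>2) - u s y * ln ((u s y)\<^sup>2))
          \<le> lam * ((2 * ln B + 2) * (v s y - u s y))"
        using \<open>lam > 0\<close> by (intro mult_left_mono) auto
      then have "vt - ut \<le> (vxx - uxx) + C * (v s y - u s y)"
        using V(3) U(3) unfolding C_def by (simp add: algebra_simps)
      then show ?thesis
        using DERIV_diff[OF V(1) U(1)] DERIV_diff[OF V(2) U(2)] by blast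
    qed
  qed (use assms in auto)
  then show ?thesis by simp
qed

section \<open>Pointwise facts about solutions and the reflection symmetry\<close>

lemma log_heat_solutionD:
  assumes "log_heat_solution lam v0 u"
  shows "u 0 x = v0 x"
    and "T > 0 \<Longrightarrow> continuous_on ({0..T} \<times> UNIV) (\<lambda>(t, x). u t x)"
    and "T > 0 \<Longrightarrow> \<exists>B. \<forall>t\<in>{0..T}. \<forall>x. \<bar>u t x\<bar> \<le> B"
    and "t > 0 \<Longrightarrow> (u t has_real_derivative deriv (u t) x) (at x)"
    and "t > 0 \<Longrightarrow> \<exists>ut uxx. ((\<lambda>s. u s x) has_real_derivative ut) (at t) \<and>
      (deriv (u t) has_real_derivative uxx) (at x) \<and> ut = uxx + lam * u t x * ln ((u t x)\<^sup>2)"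
proof -
  show "u 0 x = v0 x" and "T > 0 \<Longrightarrow> continuous_on ({0..T} \<times> UNIV) (\<lambda>(t, x). u t x)"
    using assms unfolding log_heat_solution_def by blast+
  show "\<exists>B. \<forall>t\<in>{0..T}. \<forall>x. \<bar>u t x\<bar> \<le> B" if "T > 0"
  proof -
    have "bounded ((\<lambda>(t, x). u t x) ` ({0..T} \<times> UNIV))"
      using assms that unfolding log_heat_solution_def by blast
    then obtain B where "\<And>y. y \<in> (\<lambda>(t, x). u t x) ` ({0..T} \<times> UNIV) \<Longrightarrow> norm y \<le> B"
      unfolding bounded_iff by blast
    then have "\<bar>u t x\<bar> \<le> B" if "t \<in> {0..T}" for t x
      using that by force
    then show ?thesis by blast
  qed
  assume "t > 0"
  \<comment> \<open>The time \<open>t\<close> itself serves as the horizon \<open>T\<close> of the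
    definition.\<close>
  then have t: "t \<in> {0<..t}" by simp
  note sol = assms[unfolded log_heat_solution_def, THEN conjunct1, rule_format, OF \<open>t > 0\<close>]
  have diff: "(\<lambda>s. u s x) differentiable (at t)" "u t differentiable (at x)"
    "deriv (u t) differentiable (at x)"
    and eq: "deriv (\<lambda>s. u s x) t = deriv (deriv (u t)) x + lam * u t x * ln ((u t x)\<^sup>2)"
    using sol t by blast+
  show "(u t has_real_derivative deriv (u t) x) (at x)"
    using diff(2) by (simp add: DERIV_deriv_iff_real_differentiable)
  show "\<exists>ut uxx. ((\<lambda>s. u s x) has_real_derivative ut) (at t) \<and>
      (deriv (u t) has_real_derivative uxx) (at x) \<and> ut = uxx + lam * u t x * ln ((u t x)\<^sup>2)"
    using diff(1,3) eq by (auto simp flip: DERIV_deriv_iff_real_differentiable)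
qed

text \<open>The equation is odd in \<open>u\<close>, since \<open>ln (z\<^sup>2)\<close> is even.
  This turns upper bounds for solutions into lower bounds.\<close>

lemma log_heat_solution_uminus:
  assumes "log_heat_solution lam v0 u"
  shows "log_heat_solution lam (\<lambda>x. - v0 x) (\<lambda>t x. - u t x)"
proof -
  have eq: "((\<lambda>(t, x). - u t x) ` A) = uminus ` ((\<lambda>(t, x). u t x) ` A)" for A
    by (force simp: image_image case_prod_beta)
  have dx: "deriv (\<lambda>x. - u t x) = (\<lambda>x. - deriv (u t) x)" if "t > 0" for t
    using log_heat_solutionD(4)[OF assms that] by (auto intro!: DERIV_imp_deriv DERIV_minus)
  have dt: "deriv (\<lambda>s. - u s x) t = - deriv (\<lambda>s. u s x) t" if "t > 0" for t x
    using log_heat_solutionD(5)[OF assms that, of x]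
    by (metis DERIV_imp_deriv DERIV_minus)
  have dxx: "deriv (\<lambda>x. - deriv (u t) x) x = - deriv (deriv (u t)) x" if "t > 0" for t x
    using log_heat_solutionD(5)[OF assms that, of x]
    by (metis DERIV_imp_deriv DERIV_minus)
  show ?thesis
    unfolding log_heat_solution_def
  proof (intro allI impI conjI)
    fix T :: real assume "T > 0"
    note sol = assms[unfolded log_heat_solution_def, THEN conjunct1, rule_format, OF \<open>T > 0\<close>]
    show "continuous_on ({0..T} \<times> UNIV) (\<lambda>(t, x). - u t x)"
      using continuous_on_minus[of "{0..T} \<times> UNIV" "\<lambda>(t, x). u t x"] sol
      by (simp add: case_prod_beta)
    show "bounded ((\<lambda>(t, x). - u t x) ` ({0..T} \<times> UNIV))"
      using sol unfolding eq by (simp add: bounded_uminus)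
    show "\<forall>t\<in>{0<..T}. \<forall>x. (\<lambda>s. - u s x) differentiable at t \<and>
      (\<lambda>x. - u t x) differentiable at x \<and> deriv (\<lambda>x. - u t x) differentiable at x"
      using sol by (auto simp: dx)
    show "continuous_on ({0<..T} \<times> UNIV) (\<lambda>(t, x). deriv (\<lambda>s. - u s x) t)"
    proof -
      have "continuous_on ({0<..T} \<times> UNIV) (\<lambda>p. - (\<lambda>(t, x). deriv (\<lambda>s. u s x) t) p)"
        using sol by (intro continuous_on_minus) blast
      then show ?thesis by (rule continuous_on_eq) (auto simp: dt)
    qed
    show "continuous_on ({0<..T} \<times> UNIV) (\<lambda>(t, x). deriv (\<lambda>x. - u t x) x)"
    proof -
      have "continuous_on ({0<..T} \<times> UNIV) (\<lambda>p. - (\<lambda>(t, x). deriv (u t) x) p)"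
        using sol by (intro continuous_on_minus) blast
      then show ?thesis by (rule continuous_on_eq) (auto simp: dx)
    qed
    show "continuous_on ({0<..T} \<times> UNIV) (\<lambda>(t, x). deriv (deriv (\<lambda>x. - u t x)) x)"
    proof -
      have "continuous_on ({0<..T} \<times> UNIV) (\<lambda>p. - (\<lambda>(t, x). deriv (deriv (u t)) x) p)"
        using sol by (intro continuous_on_minus) blast
      then show ?thesis by (rule continuous_on_eq) (auto simp: dx dxx)
    qed
    show "\<forall>t\<in>{0<..T}. \<forall>x. deriv (\<lambda>s. - u s x) t =
        deriv (deriv (\<lambda>x. - u t x)) x + lam * - u t x * ln ((- u t x)\<^sup>2)"
      using sol by (auto simp: dx dxx dt)
    show "\<exists>R B. \<forall>t\<in>{0..T}. \<forall>x. R \<le> \<bar>x\<bar> \<longrightarrow> \<bar>- u t x\<bar> \<le> B"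
      using sol by simp
  qed (use log_heat_solutionD(1)[OF assms] in simp)
qed

section \<open>Explicit supersolutions and subsolutions\<close>

lemma DERIV_double_exp:
  "((\<lambda>t. exp (c * exp (k * t))) has_real_derivative
    k * (c * exp (k * t)) * exp (c * exp (k * t))) (at t)" for c k t :: real
  by (rule derivative_eq_intros refl | simp)+

text \<open>The bound is an exact solution that is constant in space, and comparison takes place on
  the whole line, whose frontier is empty. The sign of \<open>c\<close> is free.\<close>

lemma log_heat_le_double_exp:
  assumes "lam > 0" and sol: "log_heat_solution lam v0 u"
    and v0: "\<And>x. v0 x \<le> exp c" and "t \<ge> 0"
  shows "u t x \<le> exp (c * exp (2 * lam * t))"
proof -
  \<comment> \<open>The extra 1 keeps the horizon positive when \<open>t = 0\<close>.\<close>
  define T where "T = t + 1"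
  have "T > 0" using \<open>t \<ge> 0\<close> by (simp add: T_def)
  obtain B where B: "\<forall>t\<in>{0..T}. \<forall>x. \<bar>u t x\<bar> \<le> B"
    using log_heat_solutionD(3)[OF sol \<open>T > 0\<close>] by blast
  show ?thesis
  proof (rule log_heat_comparison[where v = u and u = "\<lambda>t x. exp (c * exp (2 * lam * t))"
        and S = UNIV and T = T and vx = "\<lambda>t. deriv (u t)" and ux = "\<lambda>t x. 0"
        and Bv = B and Bu = 0 and lam = lam])
    show "continuous_on ({0..T} \<times> UNIV) (\<lambda>(t, x). u t x)"
      using log_heat_solutionD(2)[OF sol \<open>T > 0\<close>] .
    show "continuous_on ({0..T} \<times> UNIV) (\<lambda>(t, x). exp (c * exp (2 * lam * t)))"
      unfolding case_prod_beta by (intro continuous_intros)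
    show "u t x \<le> B" if "t \<in> {0..T}" for t x
      using B that by (meson abs_le_D1)
    show "\<exists>ut uxx. ((\<lambda>s. exp (c * exp (2 * lam * s))) has_real_derivative ut) (at t) \<and>
        ((\<lambda>x. 0) has_real_derivative uxx) (at x) \<and>
        uxx + lam * exp (c * exp (2 * lam * t)) * ln ((exp (c * exp (2 * lam * t)))\<^sup>2) \<le> ut"
      for t x :: real
      by (rule exI, rule exI, rule conjI, rule DERIV_double_exp, rule conjI, rule DERIV_const)
        (simp add: ln_realpow)
    show "\<exists>vt vxx. ((\<lambda>s. u s x) has_real_derivative vt) (at t) \<and>
        (deriv (u t) has_real_derivative vxx) (at x) \<and> vt \<le> vxx + lam * u t x * ln ((u t x)\<^sup>2)"
      if "t \<in> {0<..T}" for t x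
      using log_heat_solutionD(5)[OF sol, of t x] that by fastforce
  qed (use log_heat_solutionD(1,4)[OF sol] v0 \<open>lam > 0\<close> \<open>t \<ge> 0\<close> in \<open>auto simp: T_def\<close>)
qed

text \<open>\<open>BPC2\<close> allows break points of the second derivative, so its existence
  inside the interval comes from smoothness on \<open>{-L..L}\<close>, where relative and ordinary
  derivatives agree at interior points.\<close>

lemma plateau_function_derivatives:
  assumes "plateau_function L \<epsilon> \<Theta>"
  shows "(\<Theta> has_real_derivative deriv \<Theta> x) (at x)"
    and "x \<in> {-L<..<L} \<Longrightarrow> (deriv \<Theta> has_real_derivative deriv (deriv \<Theta>) x) (at x)"
proof -
  show \<Theta>': "(\<Theta> has_real_derivative deriv \<Theta> x) (at x)" for x
    using assms unfolding plateau_function_def BPC2_def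
    by (simp add: DERIV_deriv_iff_real_differentiable)
  assume x: "x \<in> {-L<..<L}"
  have eq: "nderiv_on {-L..L} 1 \<Theta> y = deriv \<Theta> y" if "y \<in> {-L<..<L}" for y
  proof -
    have "at y within {-L..L} = at y"
      using that by (intro at_within_interior) simp
    then show ?thesis
      using \<Theta>'[of y] by (simp add: nderiv_on_def vector_derivative_at
          has_real_derivative_iff_has_vector_derivative)
  qed
  have "nderiv_on {-L..L} 1 \<Theta> differentiable_on {-L..L}"
    using assms unfolding plateau_function_def smooth_on_def by blast
  then have "nderiv_on {-L..L} 1 \<Theta> differentiable (at x within {-L..L})"
    using x by (simp add: differentiable_on_def)
  moreover have "at x within {-L..L} = at x"
    using x by (intro at_within_interior) simp
  ultimately obtain d where "(nderiv_on {-L..L} 1 \<Theta> has_real_derivative d) (at x)"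
    by (auto simp: real_differentiable_def)
  then have "(deriv \<Theta> has_real_derivative d) (at x)"
    by (rule has_field_derivative_transform_within_open[where S = "{-L<..<L}"])
      (use x eq in auto)
  then show "(deriv \<Theta> has_real_derivative deriv (deriv \<Theta>) x) (at x)"
    by (simp add: DERIV_imp_deriv)
qed

text \<open>For \<open>w = K * \<Theta>\<close> and \<open>\<phi>\<close> the double exponential,
  the logarithm of the product splits and the \<open>\<phi>\<close> part cancels the time
  derivative. What remains is \<open>\<phi>\<close> times the stationary inequality for
  \<open>w\<close>. At the end points the subsolution vanishes while \<open>u\<close> is
  nonnegative.\<close>

lemma log_heat_ge_separated_subsolution:
  assumes "lam > 0" "K > 0" "L > 0"
    and \<Theta>: "plateau_function L \<epsilon> \<Theta>"
    and K: "\<And>x. deriv (deriv (\<lambda>y. K * \<Theta> y)) x + 2 * lam * (K * \<Theta> x) * ln (K * \<Theta> x) \<ge> 0"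
    and sol: "log_heat_solution lam v0 u"
    and v0: "\<And>x. x \<in> {-L..L} \<Longrightarrow> exp c * (K * \<Theta> x) \<le> v0 x"
    and nonneg: "\<And>x. v0 x \<ge> 0"
    and t: "t \<ge> 0" and x: "x \<in> {-L..L}"
  shows "exp (c * exp (2 * lam * t)) * (K * \<Theta> x) \<le> u t x"
proof -
  define \<phi> where "\<phi> = (\<lambda>t. exp (c * exp (2 * lam * t)))"
  define T where "T = t + 1"
  have "T > 0" using t by (simp add: T_def)
  obtain Bu where Bu: "\<forall>t\<in>{0..T}. \<forall>x. \<bar>u t x\<bar> \<le> Bu"
    using log_heat_solutionD(3)[OF sol \<open>T > 0\<close>] by blast
  have cont_w: "continuous_on A (\<lambda>(t, x). \<phi> t * (K * \<Theta> x))" for A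
  proof -
    have "continuous_on UNIV \<Theta>"
      using \<Theta> unfolding plateau_function_def BPC2_def by blast
    then have "continuous_on A (\<lambda>p. \<Theta> (snd p))"
      by (rule continuous_on_compose2) (simp_all add: continuous_on_snd)
    then show ?thesis
      unfolding \<phi>_def case_prod_beta by (intro continuous_intros)
  qed
  have "compact ((\<lambda>(t, x). \<phi> t * (K * \<Theta> x)) ` ({0..T} \<times> {-L..L}))"
    by (intro compact_continuous_image cont_w compact_Times) auto
  then have "bounded ((\<lambda>(t, x). \<phi> t * (K * \<Theta> x)) ` ({0..T} \<times> {-L..L}))"
    by (rule compact_imp_bounded)
  then obtain Bw where Bw: "\<forall>y\<in>(\<lambda>(t, x). \<phi> t * (K * \<Theta> x)) ` ({0..T} \<times> {-L..L}). norm y \<le> Bw"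
    unfolding bounded_iff by (rule exE)
  have u_nonneg: "u s y \<ge> 0" if "s \<ge> 0" for s y
  proof (rule ccontr)
    text \<open>Compare \<open>-u\<close> with \<open>\<phi>\<^sub>k\<close> and let \<open>k\<close> tend to \<open>-\<infinity>\<close>.\<close>
    assume "\<not> u s y \<ge> 0"
    then have neg: "- u s y > 0" by simp
    \<comment> \<open>A single \<open>k\<close> suffices: this one makes the bound at time
      \<open>s\<close> equal to \<open>- u s y\<close> divided by \<open>exp 1\<close>.\<close>
    define k where "k = (ln (- u s y) - 1) / exp (2 * lam * s)"
    have "- u s y \<le> exp (k * exp (2 * lam * s))"
      by (rule log_heat_le_double_exp[OF \<open>lam > 0\<close> log_heat_solution_uminus[OF sol]])
        (use nonneg that in \<open>auto intro: order_trans[of _ 0]\<close>)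
    also have "\<dots> = exp (ln (- u s y) - 1)" by (simp add: k_def)
    also have "\<dots> < exp (ln (- u s y))" by simp
    also have "\<dots> = - u s y" using neg by simp
    finally show False by simp
  qed
  have "\<phi> t * (K * \<Theta> x) \<le> u t x"
  proof (rule log_heat_comparison[where v = "\<lambda>t x. \<phi> t * (K * \<Theta> x)" and u = u
        and S = "{-L..L}" and T = T and ux = "\<lambda>t. deriv (u t)"
        and vx = "\<lambda>t x. \<phi> t * (K * deriv \<Theta> x)" and Bv = Bw and Bu = Bu and lam = lam])
    show "continuous_on ({0..T} \<times> {-L..L}) (\<lambda>(t, x). u t x)"
      using log_heat_solutionD(2)[OF sol \<open>T > 0\<close>] by (rule continuous_on_subset) auto
    show "\<phi> t * (K * \<Theta> x) \<le> Bw" if "t \<in> {0..T}" "x \<in> {-L..L}" for t x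
    proof -
      have "norm ((\<lambda>(t, x). \<phi> t * (K * \<Theta> x)) (t, x)) \<le> Bw"
        using that by (intro bspec[OF Bw] imageI) auto
      then show ?thesis by simp
    qed
    show "- Bu \<le> u t x" if "t \<in> {0..T}" for t x
      using Bu that by (meson abs_le_D2 minus_le_iff)
    show "\<phi> t * (K * \<Theta> x) \<le> u t x" if "t \<in> {0..T}" "x \<in> frontier {-L..L}" for t x
    proof -
      have "\<Theta> x = 0"
        using that(2) \<Theta> \<open>L > 0\<close> unfolding plateau_function_def by (auto simp: frontier_def)
      then show ?thesis using u_nonneg that(1) by simp
    qed
    show "((\<lambda>x. \<phi> t * (K * \<Theta> x)) has_real_derivative \<phi> t * (K * deriv \<Theta> x)) (at x)" for t x
      by (intro DERIV_cmult plateau_function_derivatives[OF \<Theta>])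
    show "\<exists>ut uxx. ((\<lambda>s. u s x) has_real_derivative ut) (at t) \<and>
        (deriv (u t) has_real_derivative uxx) (at x) \<and> uxx + lam * u t x * ln ((u t x)\<^sup>2) \<le> ut"
      if "t \<in> {0<..T}" for t x
      using log_heat_solutionD(5)[OF sol, of t x] that by fastforce
    show "\<exists>vt vxx. ((\<lambda>s. \<phi> s * (K * \<Theta> x)) has_real_derivative vt) (at t) \<and>
        ((\<lambda>y. \<phi> t * (K * deriv \<Theta> y)) has_real_derivative vxx) (at x) \<and>
        vt \<le> vxx + lam * (\<phi> t * (K * \<Theta> x)) * ln ((\<phi> t * (K * \<Theta> x))\<^sup>2)"
      if "x \<in> interior {-L..L}" for t x
    proof (intro exI conjI)
      have x: "x \<in> {-L<..<L}" using that by simp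
      have pos: "K * \<Theta> x > 0"
        using x \<Theta> \<open>K > 0\<close> unfolding plateau_function_def by simp
      show "((\<lambda>s. \<phi> s * (K * \<Theta> x)) has_real_derivative
          2 * lam * (c * exp (2 * lam * t)) * \<phi> t * (K * \<Theta> x)) (at t)"
        unfolding \<phi>_def by (intro DERIV_cmult_right DERIV_double_exp)
      show "((\<lambda>y. \<phi> t * (K * deriv \<Theta> y)) has_real_derivative
          \<phi> t * (K * deriv (deriv \<Theta>) x)) (at x)"
        by (intro DERIV_cmult plateau_function_derivatives(2)[OF \<Theta> x])
      have "deriv (\<lambda>y. K * \<Theta> y) = (\<lambda>y. K * deriv \<Theta> y)"
        by (intro ext DERIV_imp_deriv DERIV_cmult plateau_function_derivatives[OF \<Theta>])
      moreover have "deriv (\<lambda>y. K * deriv \<Theta> y) x = K * deriv (deriv \<Theta>) x"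
        by (intro DERIV_imp_deriv DERIV_cmult plateau_function_derivatives(2)[OF \<Theta> x])
      ultimately have "0 \<le> K * deriv (deriv \<Theta>) x + 2 * lam * (K * \<Theta> x) * ln (K * \<Theta> x)"
        using K[of x] by simp
      then have "0 \<le> \<phi> t * (K * deriv (deriv \<Theta>) x + 2 * lam * (K * \<Theta> x) * ln (K * \<Theta> x))"
        by (simp add: \<phi>_def)
      \<comment> \<open>Splitting the logarithm relies on \<open>\<Theta> x > 0\<close>, which holds
        because \<open>x\<close> is interior.\<close>
      moreover have "ln ((\<phi> t * (K * \<Theta> x))\<^sup>2) = 2 * (c * exp (2 * lam * t) + ln (K * \<Theta> x))"
      proof -
        have "ln ((\<phi> t * (K * \<Theta> x))\<^sup>2) = 2 * ln (\<phi> t * (K * \<Theta> x))"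
          using pos by (simp add: ln_realpow \<phi>_def)
        also have "ln (\<phi> t * (K * \<Theta> x)) = ln (\<phi> t) + ln (K * \<Theta> x)"
          using pos by (intro ln_mult_pos) (simp_all add: \<phi>_def)
        finally show ?thesis by (simp add: \<phi>_def)
      qed
      ultimately show "2 * lam * (c * exp (2 * lam * t)) * \<phi> t * (K * \<Theta> x)
          \<le> \<phi> t * (K * deriv (deriv \<Theta>) x)
            + lam * (\<phi> t * (K * \<Theta> x)) * ln ((\<phi> t * (K * \<Theta> x))\<^sup>2)"
        by (simp only:) (simp add: algebra_simps)
    qed
    show "\<phi> 0 * (K * \<Theta> x) \<le> u 0 x" if "x \<in> {-L..L}" for x
      using v0[OF that] log_heat_solutionD(1)[OF sol] by (simp add: \<phi>_def)
    show "(u t has_real_derivative deriv (u t) x) (at x)" if "t \<in> {0<..T}" for t x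
      using log_heat_solutionD(4)[OF sol] that by simp
  qed (use cont_w \<open>lam > 0\<close> t x in \<open>auto simp: T_def\<close>)
  then show ?thesis by (simp add: \<phi>_def)
qed

section \<open>Passage to the essential supremum, and choice of the two thresholds\<close>

text \<open>Continuity supplies the measurability under which a pointwise bound passes to the
  essential supremum.\<close>

lemma Linf_norm_le:
  assumes "continuous_on UNIV f" and "\<And>x. \<bar>f x\<bar> \<le> c"
  shows "Linf_norm f \<le> ereal c"
  unfolding Linf_norm_def
proof (rule esssup_I)
  have "f \<in> borel_measurable lborel"
    using borel_measurable_continuous_onI[OF assms(1)] by simp
  then show "(\<lambda>x. ereal \<bar>f x\<bar>) \<in> borel_measurable lborel" by measurable
qed (use assms(2) in simp)

theorem theorem5p5:
  fixes lam \<epsilon> L L' K0 K :: real and \<Theta> u0 :: "real \<Rightarrow> real"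
  assumes "lam > 0"
    and "0 < \<epsilon>" and "\<epsilon> < L" and "L < L'"
    and "plateau_function L \<epsilon> \<Theta>"
    and "K0 > 1"
    and "\<forall>\<kappa>\<ge>K0. \<forall>x. deriv (deriv (\<lambda>y. \<kappa> * \<Theta> y)) x + 2 * lam * (\<kappa> * \<Theta> x) * ln (\<kappa> * \<Theta> x) \<ge> 0"
    and "K \<ge> K0"
    and "BPC2 u0"
    and "\<forall>x\<in>{-L'<..<L'}. u0 x > 0"
    and "\<forall>x\<in>{..-L'} \<union> {L'..}. u0 x = 0"
  shows "(\<exists>Mdecay>0. \<forall>M. 0 < M \<and> M < Mdecay \<longrightarrow>
            (\<forall>u. log_heat_solution lam (\<lambda>x. M * u0 x) u \<longrightarrow>
               (\<exists>C>0. \<exists>\<eta>>0. \<forall>t\<ge>0.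
                  Linf_norm (u t) \<le> ereal (C * exp (- \<eta> * exp (2 * lam * t))))))
       \<and> (\<exists>Mgrowth>0. \<forall>M>Mgrowth.
            (\<forall>u. log_heat_solution lam (\<lambda>x. M * u0 x) u \<longrightarrow>
               (\<forall>t\<ge>0. \<forall>x\<in>{-L + \<epsilon>..L - \<epsilon>}.
                  u t x \<ge> K * exp (ln ((K + 1) / K) * exp (2 * lam * t)))))"
proof -
  have nonneg: "u0 x \<ge> 0" for x
  proof (cases "x \<in> {-L'<..<L'}")
    case True
    then show ?thesis using assms(10) less_imp_le by blast
  next
    case False
    then have "x \<in> {..-L'} \<union> {L'..}" by auto
    then show ?thesis using assms(11) by simp
  qed
  have cont: "continuous_on UNIV u0" "continuous_on UNIV \<Theta>"
    using assms(5,9) unfolding plateau_function_def BPC2_def by blast+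
  have "bounded (range u0)" using assms(9) unfolding BPC2_def by blast
  then obtain B0 where B0: "\<And>x. \<bar>u0 x\<bar> \<le> B0" by (auto simp: bounded_iff)
  define B where "B = max 1 B0"
  have B: "B > 0" "u0 x \<le> B" for x
    using B0[of x] by (auto simp: B_def)
  have decay: "\<exists>C>0. \<exists>\<eta>>0. \<forall>t\<ge>0. Linf_norm (u t) \<le> ereal (C * exp (- \<eta> * exp (2 * lam * t)))"
    if M: "0 < M" "M < 1 / B" and sol: "log_heat_solution lam (\<lambda>x. M * u0 x) u" for M u
  proof -
    \<comment> \<open>Then \<open>exp (- \<eta>)\<close> is the upper bound \<open>M * B\<close> of
      the initial datum, and the threshold \<open>1 / B\<close> is exactly what makes
      \<open>\<eta>\<close> positive.\<close>
    define \<eta> where "\<eta> = - ln (M * B)"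
    have "M * B < 1" using M(2) B(1) by (simp add: field_simps)
    then have "\<eta> > 0" using M(1) B(1) by (simp add: \<eta>_def)
    have exp_\<eta>: "exp (- \<eta>) = M * B" using M(1) B(1) by (simp add: \<eta>_def)
    have "Linf_norm (u t) \<le> ereal (1 * exp (- \<eta> * exp (2 * lam * t)))" if t: "t \<ge> 0" for t
    proof (rule Linf_norm_le)
      have "continuous_on ({0..t + 1} \<times> UNIV) (\<lambda>(t, x). u t x)"
        using log_heat_solutionD(2)[OF sol] t by simp
      then show "continuous_on UNIV (u t)"
        using continuous_on_compose2[of "{0..t + 1} \<times> UNIV" "\<lambda>(t, x). u t x" UNIV "Pair t"] t
        by (force intro: continuous_on_Pair continuous_on_const continuous_on_id)
      have "u t x \<le> exp (- \<eta> * exp (2 * lam * t))" for x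
        by (rule log_heat_le_double_exp[OF \<open>lam > 0\<close> sol _ t])
          (use M(1) B in \<open>simp add: exp_\<eta>\<close>)
      moreover have "- u t x \<le> exp (- \<eta> * exp (2 * lam * t))" for x
        by (rule log_heat_le_double_exp[OF \<open>lam > 0\<close> log_heat_solution_uminus[OF sol] _ t])
          (use M(1) nonneg in \<open>auto intro: order_trans[of _ 0]\<close>)
      ultimately show "\<bar>u t x\<bar> \<le> 1 * exp (- \<eta> * exp (2 * lam * t))" for x
        by (simp add: abs_le_iff)
    qed
    then show ?thesis using \<open>\<eta> > 0\<close> zero_less_one by blast
  qed
  have L: "L > 0" and K: "K > 1" using assms by linarith+
  \<comment> \<open>Because \<open>L < L'\<close>, the datum \<open>u0\<close> has a positive
    minimum on the compact interval \<open>{-L..L}\<close>, attained at \<open>y\<close>.\<close>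
  have "compact {-L..L}" "{-L..L} \<noteq> {}" using L by auto
  then obtain y where y: "y \<in> {-L..L}" "\<And>x. x \<in> {-L..L} \<Longrightarrow> u0 y \<le> u0 x"
    using continuous_attains_inf continuous_on_subset[OF cont(1)] by (metis subset_UNIV)
  have m: "u0 y > 0" using assms(4,10) y(1) by auto
  have "bounded (range \<Theta>)" using assms(5) unfolding plateau_function_def BPC2_def by blast
  then obtain b0 where b0: "\<And>x. \<bar>\<Theta> x\<bar> \<le> b0" by (auto simp: bounded_iff)
  define b where "b = max 1 b0"
  have b: "b > 0" "\<Theta> x \<le> b" for x
    using b0[of x] by (auto simp: b_def)
  \<comment> \<open>With this \<open>c\<close> the subsolution starts from
    \<open>(K + 1) * \<Theta>\<close>.\<close>
  define c where "c = ln ((K + 1) / K)"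
  have exp_c: "exp c * K = K + 1" using K by (simp add: c_def)
  \<comment> \<open>The threshold for \<open>M\<close> puts \<open>M * u0\<close> above
    \<open>(K + 1) * b\<close> on \<open>{-L..L}\<close>, hence above the initial
    subsolution.\<close>
  have growth: "u t x \<ge> K * exp (c * exp (2 * lam * t))"
    if M: "M > (K + 1) * b / u0 y" and sol: "log_heat_solution lam (\<lambda>x. M * u0 x) u"
      and t: "t \<ge> 0" and x: "x \<in> {-L + \<epsilon>..L - \<epsilon>}" for M u t x
  proof -
    have "(K + 1) * b / u0 y > 0" using m K b(1) by simp
    then have "M > 0" using M by linarith
    have "exp (c * exp (2 * lam * t)) * (K * \<Theta> x) \<le> u t x"
    proof (rule log_heat_ge_separated_subsolution[OF \<open>lam > 0\<close> _ L assms(5) _ sol])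
      show "exp c * (K * \<Theta> x) \<le> M * u0 x" if "x \<in> {-L..L}" for x
      proof -
        have "exp c * (K * \<Theta> x) = (K + 1) * \<Theta> x"
          using exp_c by (metis mult.assoc)
        also have "\<dots> \<le> (K + 1) * b" using b(2) K by simp
        also have "\<dots> \<le> M * u0 y" using M m by (simp add: field_simps)
        also have "\<dots> \<le> M * u0 x" using y(2)[OF that] \<open>M > 0\<close> by simp
        finally show ?thesis .
      qed
    qed (use assms(2,7,8) K \<open>M > 0\<close> nonneg t x in auto)
    \<comment> \<open>On the plateau the subsolution reduces to the claimed lower bound.\<close>
    moreover have "\<Theta> x = 1" using assms(5) x unfolding plateau_function_def by blast
    ultimately show ?thesis by (simp add: mult.commute)
  qed
  have "1 / B > 0" "(K + 1) * b / u0 y > 0" using m K b(1) B(1) by simp_all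
  then show ?thesis
    using decay growth unfolding c_def by blast
qed

end
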